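(* Let $J$ be a nonempty set and regard $C_3^J$ as a core regular double Stone algebra. Let $\langle U,\theta\rangle$ be the approximation space given by $U=J\times\{0,1\}$ and the equivalence relation $\theta$ whose set of classes is $\{\{(j,0),(j,1)\}:j\in J\}$, and let $R_\theta$ be the principal rough set algebra resulting from $\langle U,\theta\rangle$. Then $R_\theta\cong C_3^J$ (as core regular double Stone algebras).
   Context: An approximation space $\langle U,\theta\rangle$ is a nonempty set $U$ with an equivalence relation $\theta$; $\theta_x$ denotes the $\theta$-class of $x$. For $X\subseteq U$, $\overline{X}=\bigcup\{\theta_x:\theta_x\cap X\neq\emptyset\}$ and $\underline{X}=\bigcup\{\theta_x:\theta_x\subseteq X\}$; the pair $\langle\underline{X},\overline{X}\rangle$ is a rough set. $R_\theta$ is the set of all rough sets $\langle\underline{X},\overline{X}\rangle$, $X\subseteq U$. Complements $^c$ are in $U$. The principal rough set algebra, also denoted $R_\theta$, has $0=\langle\emptyset,\emptyset\rangle$, $1=\langle U,U\rangle$, componentwise union as $\vee$, componentwise intersection as $\wedge$, $\langle\underline{X},\overline{X}\rangle^*=\langle\overline{X}^c,\overline{X}^c\rangle$ and $\langle\underline{X},\overline{X}\rangle^+=\langle\underline{X}^c,\underline{X}^c\rangle$. A double Stone algebra $\langle L,\wedge,\vee,*,+,0,1\rangle$ is a bounded distributive lattice with unary operations such that $y\le x^*\iff y\wedge x=0$, $y\ge x^+\iff y\vee x=1$, $x^*\vee x^{**}=1$ and $x^+\wedge x^{++}=0$. It is regular if $x\wedge x^+\le y\vee y^*$ for all $x,y$.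 An element $x$ is dense if $x^*=0$ and dually dense if $x^+=1$; the core is the set of elements that are both. A core regular double Stone algebra (CRDSA) is a regular double Stone algebra with nonempty core; the core then has a unique element $h$, treated as a constant, so a CRDSA is an algebra $\langle L,\wedge,\vee,*,+,0,1,h\rangle$, and CRDSA isomorphisms preserve all these operations and constants. $C_3=\{0<h<1\}$ is the 3-element chain with $0^*=1,\ h^*=0,\ 1^*=0$ and $0^+=1,\ h^+=1,\ 1^+=0$; $C_3^J$ carries pointwise operations. *)

theory Defs
  imports Main "HOL-Library.FuncSet"
begin

definition lower_approx :: "'u set \<Rightarrow> ('u \<times> 'u) set \<Rightarrow> 'u set \<Rightarrow> 'u set" where
  "lower_approx U \<theta> X = \<Union>{\<theta> `` {x} | x. x \<in> U \<and> \<theta> `` {x} \<subseteq> X}"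

definition upper_approx :: "'u set \<Rightarrow> ('u \<times> 'u) set \<Rightarrow> 'u set \<Rightarrow> 'u set" where
  "upper_approx U \<theta> X = \<Union>{\<theta> `` {x} | x. x \<in> U \<and> \<theta> `` {x} \<inter> X \<noteq> {}}"

definition rough_sets :: "'u set \<Rightarrow> ('u \<times> 'u) set \<Rightarrow> ('u set \<times> 'u set) set" where
  "rough_sets U \<theta> = {(lower_approx U \<theta> X, upper_approx U \<theta> X) | X. X \<subseteq> U}"

record 'a dsa =
  carrier :: "'a set"
  meet :: "'a \<Rightarrow> 'a \<Rightarrow> 'a" (infixl \<open>\<sqinter>\<index>\<close> 70)
  join :: "'a \<Rightarrow> 'a \<Rightarrow> 'a" (infixl \<open>\<squnion>\<index>\<close> 65)
  pcompl :: "'a \<Rightarrow> 'a" (\<open>\<sim>\<index> _\<close> [81] 80)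
  dpcompl :: "'a \<Rightarrow> 'a" (\<open>\<rhd>\<index> _\<close> [81] 80)
  zero_elt :: 'a (\<open>\<zero>\<index>\<close>)
  one_elt :: 'a (\<open>\<one>\<index>\<close>)

record 'a crdsa = "'a dsa" +
  core_elt :: 'a

definition lat_le :: "('a, 'b) dsa_scheme \<Rightarrow> 'a \<Rightarrow> 'a \<Rightarrow> bool" (infix \<open>\<sqsubseteq>\<index>\<close> 50) where
  "x \<sqsubseteq>\<^bsub>L\<^esub> y \<longleftrightarrow> x \<sqinter>\<^bsub>L\<^esub> y = x"

locale bounded_distrib_lattice =
  fixes L :: "('a, 'b) dsa_scheme" (structure)
  assumes meet_closed: "\<lbrakk>x \<in> carrier L; y \<in> carrier L\<rbrakk> \<Longrightarrow> x \<sqinter> y \<in> carrier L"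
    and join_closed: "\<lbrakk>x \<in> carrier L; y \<in> carrier L\<rbrakk> \<Longrightarrow> x \<squnion> y \<in> carrier L"
    and zero_closed: "\<zero> \<in> carrier L"
    and one_closed: "\<one> \<in> carrier L"
    and meet_assoc: "\<lbrakk>x \<in> carrier L; y \<in> carrier L; z \<in> carrier L\<rbrakk> \<Longrightarrow> (x \<sqinter> y) \<sqinter> z = x \<sqinter> (y \<sqinter> z)"
    and join_assoc: "\<lbrakk>x \<in> carrier L; y \<in> carrier L; z \<in> carrier L\<rbrakk> \<Longrightarrow> (x \<squnion> y) \<squnion> z = x \<squnion> (y \<squnion> z)"
    and meet_commute: "\<lbrakk>x \<in> carrier L; y \<in> carrier L\<rbrakk> \<Longrightarrow> x \<sqinter> y = y \<sqinter> x"
    and join_commute: "\<lbrakk>x \<in> carrier L; y \<in> carrier L\<rbrakk> \<Longrightarrow> x \<squnion> y = y \<squnion> x"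
    and meet_join_absorb: "\<lbrakk>x \<in> carrier L; y \<in> carrier L\<rbrakk> \<Longrightarrow> x \<sqinter> (x \<squnion> y) = x"
    and join_meet_absorb: "\<lbrakk>x \<in> carrier L; y \<in> carrier L\<rbrakk> \<Longrightarrow> x \<squnion> (x \<sqinter> y) = x"
    and distrib: "\<lbrakk>x \<in> carrier L; y \<in> carrier L; z \<in> carrier L\<rbrakk> \<Longrightarrow> x \<sqinter> (y \<squnion> z) = (x \<sqinter> y) \<squnion> (x \<sqinter> z)"
    and zero_least: "x \<in> carrier L \<Longrightarrow> \<zero> \<sqsubseteq> x"
    and one_greatest: "x \<in> carrier L \<Longrightarrow> x \<sqsubseteq> \<one>"

locale double_stone_algebra = bounded_distrib_lattice +
  assumes pcompl_closed: "x \<in> carrier L \<Longrightarrow> \<sim>x \<in> carrier L"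
    and dpcompl_closed: "x \<in> carrier L \<Longrightarrow> \<rhd>x \<in> carrier L"
    and pcompl: "\<lbrakk>x \<in> carrier L; y \<in> carrier L\<rbrakk> \<Longrightarrow> y \<sqsubseteq> \<sim>x \<longleftrightarrow> y \<sqinter> x = \<zero>"
    and dpcompl: "\<lbrakk>x \<in> carrier L; y \<in> carrier L\<rbrakk> \<Longrightarrow> \<rhd>x \<sqsubseteq> y \<longleftrightarrow> y \<squnion> x = \<one>"
    and stone: "x \<in> carrier L \<Longrightarrow> \<sim>x \<squnion> \<sim>(\<sim>x) = \<one>"
    and dual_stone: "x \<in> carrier L \<Longrightarrow> \<rhd>x \<sqinter> \<rhd>(\<rhd>x) = \<zero>"

locale regular_double_stone_algebra = double_stone_algebra +
  assumes regular: "\<lbrakk>x \<in> carrier L; y \<in> carrier L\<rbrakk> \<Longrightarrow> x \<sqinter> \<rhd>x \<sqsubseteq> y \<squnion> \<sim>y"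

definition core :: "('a, 'b) dsa_scheme \<Rightarrow> 'a set" where
  "core L = {x \<in> carrier L. pcompl L x = zero_elt L \<and> dpcompl L x = one_elt L}"

text \<open>
  The constant lies in the core, so the core is nonempty; regularity makes it unique.
\<close>

locale core_regular_double_stone_algebra = regular_double_stone_algebra L
  for L :: "('a, 'b) crdsa_scheme" (structure) +
  assumes core_elt_in_core: "core_elt L \<in> core L"

text \<open>
  Expansion of an algebra without the constant \<open>h\<close> by the element of its core;
  meaningful only when the core is a singleton, as it is for a regular double Stone
  algebra with nonempty core.
\<close>

definition add_core_elt :: "'a dsa \<Rightarrow> 'a crdsa" where
  "add_core_elt L = dsa.extend L (crdsa.fields (THE x. x \<in> core L))"

definition crdsa_iso :: "('a, 'c) crdsa_scheme \<Rightarrow> ('b, 'd) crdsa_scheme \<Rightarrow> ('a \<Rightarrow> 'b) set" where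
  "crdsa_iso A B = {f. bij_betw f (carrier A) (carrier B) \<and>
     (\<forall>x \<in> carrier A. \<forall>y \<in> carrier A. f (x \<sqinter>\<^bsub>A\<^esub> y) = f x \<sqinter>\<^bsub>B\<^esub> f y) \<and>
     (\<forall>x \<in> carrier A. \<forall>y \<in> carrier A. f (x \<squnion>\<^bsub>A\<^esub> y) = f x \<squnion>\<^bsub>B\<^esub> f y) \<and>
     (\<forall>x \<in> carrier A. f (\<sim>\<^bsub>A\<^esub> x) = \<sim>\<^bsub>B\<^esub> (f x)) \<and>
     (\<forall>x \<in> carrier A. f (\<rhd>\<^bsub>A\<^esub> x) = \<rhd>\<^bsub>B\<^esub> (f x)) \<and>
     f \<zero>\<^bsub>A\<^esub> = \<zero>\<^bsub>B\<^esub> \<and> f \<one>\<^bsub>A\<^esub> = \<one>\<^bsub>B\<^esub> \<and> f (core_elt A) = core_elt B}"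

definition crdsa_isomorphic :: "('a, 'c) crdsa_scheme \<Rightarrow> ('b, 'd) crdsa_scheme \<Rightarrow> bool"
  (infix \<open>\<cong>\<close> 50) where
  "A \<cong> B \<longleftrightarrow> core_regular_double_stone_algebra A \<and> core_regular_double_stone_algebra B \<and>
     crdsa_iso A B \<noteq> {}"

definition rough_algebra :: "'u set \<Rightarrow> ('u \<times> 'u) set \<Rightarrow> ('u set \<times> 'u set) dsa" where
  "rough_algebra U \<theta> = \<lparr>
     carrier = rough_sets U \<theta>,
     meet = (\<lambda>(a, b) (c, d). (a \<inter> c, b \<inter> d)),
     join = (\<lambda>(a, b) (c, d). (a \<union> c, b \<union> d)),
     pcompl = (\<lambda>(a, b). (U - b, U - b)),
     dpcompl = (\<lambda>(a, b). (U - a, U - a)),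
     zero_elt = ({}, {}),
     one_elt = (U, U)\<rparr>"

datatype three = Bottom | Middle | Top

instantiation three :: linorder
begin

definition less_eq_three :: "three \<Rightarrow> three \<Rightarrow> bool" where
  "x \<le> y \<longleftrightarrow> x = Bottom \<or> y = Top \<or> x = y"

definition less_three :: "three \<Rightarrow> three \<Rightarrow> bool" where
  "x < y \<longleftrightarrow> x \<le> y \<and> x \<noteq> (y :: three)"

instance
  by standard (auto simp: less_eq_three_def less_three_def intro: three.exhaust)

end

definition C3 :: "three crdsa" where
  "C3 = \<lparr>
     carrier = UNIV,
     meet = min,
     join = max,
     pcompl = (\<lambda>x. case x of Bottom \<Rightarrow> Top | Middle \<Rightarrow> Bottom | Top \<Rightarrow> Bottom),
     dpcompl = (\<lambda>x. case x of Bottom \<Rightarrow> Top | Middle \<Rightarrow> Top | Top \<Rightarrow> Bottom),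
     zero_elt = Bottom,
     one_elt = Top,
     core_elt = Middle\<rparr>"

definition power_algebra :: "'a crdsa \<Rightarrow> 'j set \<Rightarrow> ('j \<Rightarrow> 'a) crdsa" where
  "power_algebra A J = \<lparr>
     carrier = J \<rightarrow>\<^sub>E carrier A,
     meet = (\<lambda>f g. \<lambda>j\<in>J. f j \<sqinter>\<^bsub>A\<^esub> g j),
     join = (\<lambda>f g. \<lambda>j\<in>J. f j \<squnion>\<^bsub>A\<^esub> g j),
     pcompl = (\<lambda>f. \<lambda>j\<in>J. \<sim>\<^bsub>A\<^esub> (f j)),
     dpcompl = (\<lambda>f. \<lambda>j\<in>J. \<rhd>\<^bsub>A\<^esub> (f j)),
     zero_elt = (\<lambda>j\<in>J. \<zero>\<^bsub>A\<^esub>),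
     one_elt = (\<lambda>j\<in>J. \<one>\<^bsub>A\<^esub>),
     core_elt = (\<lambda>j\<in>J. core_elt A)\<rparr>"

end

theory Submission imports Defs begin

text \<open>
  A rough set is determined by recording, for each class, whether it lies in the lower
  approximation (\<open>Top\<close>), only in the upper one (\<open>Middle\<close>), or in neither (\<open>Bottom\<close>).
  Every function \<open>J \<rightarrow> C3\<close> arises in this way because a class with two elements can be met
  without being contained. The operations correspond coordinatewise, so the rough set algebra
  inherits the axioms from \<open>C3\<close>.
\<close>

lemma C3_crdsa: "core_regular_double_stone_algebra C3"
proof -
  have simps: "min x y = (if x \<le> y then x else y)" "max x y = (if x \<le> y then y else x)" for x y :: three
    by (simp_all add: min_def max_def)
  show ?thesis
    by (unfold_locales,
      auto simp: C3_def core_def lat_le_def simps less_eq_three_def split: three.splits if_splits)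
      (metis three.exhaust)+
qed

lemma restrict_eq_iff: "(\<lambda>j\<in>J. F j) = (\<lambda>j\<in>J. G j) \<longleftrightarrow> (\<forall>j\<in>J. F j = G j)"
  by (auto simp: fun_eq_iff restrict_def)

text \<open>Both sides are \<open>undefined\<close> off \<open>J\<close>, so only values on
  \<open>J\<close> matter. The absorption and order axioms of a power lead to equations of this
  shape, with a bare carrier element on one side.\<close>

lemma restrict_eq_PiE_iff:
  assumes "f \<in> J \<rightarrow>\<^sub>E S"
  shows "(\<lambda>j\<in>J. F j) = f \<longleftrightarrow> (\<forall>j\<in>J. F j = f j)"
  using assms by (auto simp: fun_eq_iff restrict_def PiE_def extensional_def)

text \<open>Every axiom is an identity or an equivalence between identities,
  \<open>\<sqsubseteq>\<close> being itself an equation, and so passes to all coordinates at once.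
  Membership in the core is equational too.\<close>

lemma power_algebra_crdsa:
  assumes "core_regular_double_stone_algebra A"
  shows "core_regular_double_stone_algebra (power_algebra A J)"
proof -
  interpret A: core_regular_double_stone_algebra A by fact
  have core_A: "core_elt A \<in> carrier A" "\<sim>\<^bsub>A\<^esub> (core_elt A) = \<zero>\<^bsub>A\<^esub>" "\<rhd>\<^bsub>A\<^esub> (core_elt A) = \<one>\<^bsub>A\<^esub>"
    using A.core_elt_in_core by (auto simp: core_def)
  have mem: "f j \<in> carrier A" if "f \<in> J \<rightarrow>\<^sub>E carrier A" "j \<in> J" for f j
    using that by (rule PiE_mem)
  show ?thesis
    by (unfold_locales,
      auto simp: power_algebra_def core_def lat_le_def restrict_eq_iff restrict_eq_PiE_iff
        mem A.meet_closed A.join_closed A.zero_closed A.one_closed A.pcompl_closed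
        A.dpcompl_closed A.join_assoc A.meet_join_absorb A.join_meet_absorb
        A.zero_least[unfolded lat_le_def] A.one_greatest[unfolded lat_le_def] A.stone A.dual_stone
        A.pcompl[unfolded lat_le_def] A.dpcompl[unfolded lat_le_def]
        A.regular[unfolded lat_le_def] core_A)
      (rule A.meet_commute A.join_commute A.meet_assoc A.distrib; simp add: mem)+
qed

text \<open>Transport of structure: \<open>crdsa_iso\<close> does not presuppose any axiom for
  \<open>B\<close>, so the rough set algebra can obtain its axioms this way.\<close>

lemma crdsa_iso_image:
  assumes A: "core_regular_double_stone_algebra A" and f: "f \<in> crdsa_iso A B"
  shows "core_regular_double_stone_algebra B"
proof -
  interpret A: core_regular_double_stone_algebra A by fact
  have inj: "inj_on f (carrier A)" and carrier: "carrier B = f ` carrier A"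
    and zero: "\<zero>\<^bsub>B\<^esub> = f \<zero>\<^bsub>A\<^esub>" and one: "\<one>\<^bsub>B\<^esub> = f \<one>\<^bsub>A\<^esub>" and core: "core_elt B = f (core_elt A)"
    using f by (auto simp: crdsa_iso_def bij_betw_def)
  \<comment> \<open>Oriented to pull \<open>f\<close> outwards: an equation in \<open>B\<close>
    becomes one between two values of \<open>f\<close>, and injectivity reduces it to an equation in
    \<open>A\<close>.\<close>
  have ops:
    "\<And>x y. x \<in> carrier A \<Longrightarrow> y \<in> carrier A \<Longrightarrow> f x \<sqinter>\<^bsub>B\<^esub> f y = f (x \<sqinter>\<^bsub>A\<^esub> y)"
    "\<And>x y. x \<in> carrier A \<Longrightarrow> y \<in> carrier A \<Longrightarrow> f x \<squnion>\<^bsub>B\<^esub> f y = f (x \<squnion>\<^bsub>A\<^esub> y)"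
    "\<And>x. x \<in> carrier A \<Longrightarrow> \<sim>\<^bsub>B\<^esub> (f x) = f (\<sim>\<^bsub>A\<^esub> x)"
    "\<And>x. x \<in> carrier A \<Longrightarrow> \<rhd>\<^bsub>B\<^esub> (f x) = f (\<rhd>\<^bsub>A\<^esub> x)"
    using f by (auto simp: crdsa_iso_def)
  note closed = A.meet_closed A.join_closed A.zero_closed A.one_closed A.pcompl_closed
    A.dpcompl_closed
  have core_A: "core_elt A \<in> carrier A" "\<sim>\<^bsub>A\<^esub> (core_elt A) = \<zero>\<^bsub>A\<^esub>" "\<rhd>\<^bsub>A\<^esub> (core_elt A) = \<one>\<^bsub>A\<^esub>"
    using A.core_elt_in_core by (auto simp: core_def)
  show ?thesis
    by (unfold_locales,
      auto simp: carrier zero one core core_def lat_le_def ops closed inj_on_eq_iff[OF inj] core_A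
        A.join_assoc A.meet_join_absorb A.join_meet_absorb
        A.zero_least[unfolded lat_le_def] A.one_greatest[unfolded lat_le_def] A.stone A.dual_stone
        A.pcompl[unfolded lat_le_def] A.dpcompl[unfolded lat_le_def]
        A.regular[unfolded lat_le_def])
      (rule A.meet_commute A.join_commute A.meet_assoc A.distrib; assumption)+
qed

text \<open>Reverses direction: the explicit map \<open>rough_of\<close> starts from the power of
  \<open>C3\<close>, while the isomorphism is wanted from the rough set algebra.\<close>

lemma crdsa_iso_inv_into:
  assumes A: "core_regular_double_stone_algebra A" and f: "f \<in> crdsa_iso A B"
  shows "inv_into (carrier A) f \<in> crdsa_iso B A"
proof -
  interpret A: core_regular_double_stone_algebra A by fact
  have bij: "bij_betw f (carrier A) (carrier B)" using f by (simp add: crdsa_iso_def)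
  have carrier: "carrier B = f ` carrier A" using bij by (simp add: bij_betw_def)
  have core: "core_elt A \<in> carrier A"
    using A.core_elt_in_core by (simp add: core_def)
  have left: "inv_into (carrier A) f (f x) = x" if "x \<in> carrier A" for x
    using that bij by (rule bij_betw_inv_into_left[rotated])
  have ops:
    "\<And>x y. x \<in> carrier A \<Longrightarrow> y \<in> carrier A \<Longrightarrow> f x \<sqinter>\<^bsub>B\<^esub> f y = f (x \<sqinter>\<^bsub>A\<^esub> y)"
    "\<And>x y. x \<in> carrier A \<Longrightarrow> y \<in> carrier A \<Longrightarrow> f x \<squnion>\<^bsub>B\<^esub> f y = f (x \<squnion>\<^bsub>A\<^esub> y)"
    "\<And>x. x \<in> carrier A \<Longrightarrow> \<sim>\<^bsub>B\<^esub> (f x) = f (\<sim>\<^bsub>A\<^esub> x)"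
    "\<And>x. x \<in> carrier A \<Longrightarrow> \<rhd>\<^bsub>B\<^esub> (f x) = f (\<rhd>\<^bsub>A\<^esub> x)"
    "\<zero>\<^bsub>B\<^esub> = f \<zero>\<^bsub>A\<^esub>" "\<one>\<^bsub>B\<^esub> = f \<one>\<^bsub>A\<^esub>" "core_elt B = f (core_elt A)"
    using f by (auto simp: crdsa_iso_def)
  show ?thesis
    using bij_betw_inv_into[OF bij]
    by (simp add: crdsa_iso_def carrier ops left core A.meet_closed A.join_closed A.zero_closed
        A.one_closed A.pcompl_closed A.dpcompl_closed)
qed

text \<open>Going from functions to pairs avoids choosing a set \<open>X\<close> that represents a
  given rough set.\<close>

definition rough_of :: "'j set \<Rightarrow> ('j \<Rightarrow> three) \<Rightarrow> ('j \<times> nat) set \<times> ('j \<times> nat) set" where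
  "rough_of J f = ({j \<in> J. f j = Top} \<times> {0, 1}, {j \<in> J. f j \<noteq> Bottom} \<times> {0, 1})"

context
  fixes J :: "'j set" and U :: "('j \<times> nat) set" and \<theta> :: "(('j \<times> nat) \<times> ('j \<times> nat)) set"
  assumes U: "U = J \<times> {0, 1}"
    and classes: "U // \<theta> = {{(j, 0), (j, 1)} | j. j \<in> J}"
begin

text \<open>The images of points of \<open>U\<close> under \<open>\<theta>\<close> are exactly the
  members of the quotient. Leaving \<open>P\<close> free serves both approximations: contained in
  \<open>X\<close>, or meeting \<open>X\<close>.\<close>

lemma Union_classes:
  "\<Union>{\<theta> `` {x} | x. x \<in> U \<and> P (\<theta> `` {x})} = {j \<in> J. P {(j, 0), (j, 1)}} \<times> {0, 1}"
proof -
  have "{\<theta> `` {x} | x. x \<in> U \<and> P (\<theta> `` {x})} = {C \<in> U // \<theta>. P C}"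
    unfolding quotient_def by blast
  also have "\<dots> = {{(j, 0), (j, 1)} | j. j \<in> J \<and> P {(j, 0), (j, 1)}}"
    unfolding classes by blast
  finally show ?thesis by auto
qed

lemma lower_approx_eq:
  "lower_approx U \<theta> X = {j \<in> J. (j, 0) \<in> X \<and> (j, 1) \<in> X} \<times> {0, 1}"
  unfolding lower_approx_def by (subst Union_classes) simp

lemma upper_approx_eq:
  "upper_approx U \<theta> X = {j \<in> J. (j, 0) \<in> X \<or> (j, 1) \<in> X} \<times> {0, 1}"
  unfolding upper_approx_def by (subst Union_classes) auto

lemma rough_sets_eq: "rough_sets U \<theta> = rough_of J ` (J \<rightarrow>\<^sub>E UNIV)"
proof (intro equalityI subsetI)
  fix r assume "r \<in> rough_sets U \<theta>"
  then obtain X where r: "r = (lower_approx U \<theta> X, upper_approx U \<theta> X)"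
    by (auto simp: rough_sets_def)
  \<comment> \<open>\<open>f\<close> reflects how many points of each class lie in \<open>X\<close>:
    two, one or none.\<close>
  define f where "f = (\<lambda>j\<in>J. if (j, 0) \<in> X \<and> (j, 1) \<in> X then Top
      else if (j, 0) \<in> X \<or> (j, 1) \<in> X then Middle else Bottom)"
  have "r = rough_of J f"
    by (auto simp: r rough_of_def f_def lower_approx_eq upper_approx_eq split: if_splits)
  moreover have "f \<in> J \<rightarrow>\<^sub>E UNIV" by (simp add: f_def)
  ultimately show "r \<in> rough_of J ` (J \<rightarrow>\<^sub>E UNIV)" by blast
next
  fix r assume "r \<in> rough_of J ` (J \<rightarrow>\<^sub>E UNIV)"
  then obtain f where r: "r = rough_of J f" by blast
  \<comment> \<open>A class with value \<open>Middle\<close> contributes only \<open>(j, 0)\<close>: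
    it is met by \<open>X\<close>, but the missing \<open>(j, 1)\<close> keeps it out of the lower
    approximation.\<close>
  define X where "X = {j \<in> J. f j = Top} \<times> {0, 1::nat} \<union> {j \<in> J. f j = Middle} \<times> {0}"
  have "r = (lower_approx U \<theta> X, upper_approx U \<theta> X)"
    by (auto simp: r rough_of_def X_def lower_approx_eq upper_approx_eq intro: three.exhaust)
  moreover have "X \<subseteq> U" by (auto simp: X_def U)
  ultimately show "r \<in> rough_sets U \<theta>" by (auto simp: rough_sets_def)
qed

lemma inj_on_rough_of: "inj_on (rough_of J) (J \<rightarrow>\<^sub>E UNIV)"
proof (rule inj_onI)
  fix f g assume f: "f \<in> J \<rightarrow>\<^sub>E UNIV" and g: "g \<in> J \<rightarrow>\<^sub>E UNIV" and eq: "rough_of J f = rough_of J g"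
  \<comment> \<open>The nonempty factor \<open>{0, 1}\<close> cancels in both components; being
    \<open>Top\<close> and being \<open>Bottom\<close> then tell the three values apart.\<close>
  have "{j \<in> J. f j = Top} = {j \<in> J. g j = Top}" "{j \<in> J. f j \<noteq> Bottom} = {j \<in> J. g j \<noteq> Bottom}"
    using eq by (auto simp: rough_of_def times_eq_iff)
  then have "f j = g j" if "j \<in> J" for j
    using that by (cases "f j"; cases "g j") force+
  then show "f = g" using f g by (rule PiE_ext[rotated 2])
qed

text \<open>A singleton core gives meaning to the definite description in
  \<open>add_core_elt\<close>. For a rough set \<open>(a, b)\<close>, zero pseudocomplement forces
  \<open>b = U\<close>, and dual pseudocomplement one forces \<open>a = {}\<close>.\<close>

lemma core_rough_algebra: "core (rough_algebra U \<theta>) = {({}, U)}"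
proof -
  \<comment> \<open>Constant \<open>Middle\<close>: every class is met and none is
    contained.\<close>
  have "({}, U) = rough_of J (\<lambda>j\<in>J. Middle)" by (auto simp: rough_of_def U)
  then have "({}, U) \<in> rough_sets U \<theta>"
    unfolding rough_sets_eq by (rule image_eqI[of _ "rough_of J"]) simp
  moreover have "r = ({}, U)" if "r \<in> core (rough_algebra U \<theta>)" for r
  proof -
    obtain a b where r: "r = (a, b)" by (cases r)
    have ab: "(a, b) \<in> rough_sets U \<theta>" "U - b = {}" "U - a = U"
      using that by (auto simp: r core_def rough_algebra_def)
    from ab(1)[unfolded rough_sets_eq] obtain f where "(a, b) = rough_of J f" ..
    then have "a \<subseteq> U" "b \<subseteq> U" by (auto simp: rough_of_def U)
    then show ?thesis using ab(2,3) unfolding r by blast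
  qed
  ultimately show ?thesis by (auto simp: core_def rough_algebra_def)
qed

lemma rough_of_iso:
  "rough_of J \<in> crdsa_iso (power_algebra C3 J) (add_core_elt (rough_algebra U \<theta>))"
proof -
  \<comment> \<open>\<open>rough_of\<close> only tests values for \<open>Top\<close> and
    \<open>Bottom\<close>, so the operations need describing only under these two tests.\<close>
  have min: "min x y = Top \<longleftrightarrow> x = Top \<and> y = Top" "min x y = Bottom \<longleftrightarrow> x = Bottom \<or> y = Bottom"
    and max: "max x y = Top \<longleftrightarrow> x = Top \<or> y = Top" "max x y = Bottom \<longleftrightarrow> x = Bottom \<and> y = Bottom"
    for x y :: three
    by (cases x; cases y; simp add: min_def max_def less_eq_three_def)+
  have pcompl: "\<sim>\<^bsub>C3\<^esub> x = (if x = Bottom then Top else Bottom)"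
    and dpcompl: "\<rhd>\<^bsub>C3\<^esub> x = (if x = Top then Bottom else Top)" for x
    by (cases x; simp add: C3_def)+
  have core: "(THE x. x \<in> core (rough_algebra U \<theta>)) = ({}, U)"
    by (simp add: core_rough_algebra)
  have "bij_betw (rough_of J) (J \<rightarrow>\<^sub>E UNIV) (rough_sets U \<theta>)"
    by (simp add: bij_betw_def inj_on_rough_of rough_sets_eq)
  then show ?thesis
    unfolding crdsa_iso_def add_core_elt_def core
    \<comment> \<open>The complements are rewritten before \<open>C3_def\<close> is unfolded, as
      \<open>pcompl\<close> and \<open>dpcompl\<close> would no longer match afterwards.\<close>
    by (auto simp: power_algebra_def pcompl dpcompl)
      (auto simp: C3_def rough_algebra_def dsa.defs crdsa.defs rough_of_def U min max)
qed

end

theorem proposition5: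
  fixes J :: "'j set" and U :: "('j \<times> nat) set" and \<theta> :: "(('j \<times> nat) \<times> ('j \<times> nat)) set"
  assumes "J \<noteq> {}"
    and "U = J \<times> {0, 1}"
    and "equiv U \<theta>"
    and "U // \<theta> = {{(j, 0), (j, 1)} | j. j \<in> J}"
  shows "add_core_elt (rough_algebra U \<theta>) \<cong> power_algebra C3 J"
proof -
  have power: "core_regular_double_stone_algebra (power_algebra C3 J)"
    by (rule power_algebra_crdsa[OF C3_crdsa])
  have iso: "rough_of J \<in> crdsa_iso (power_algebra C3 J) (add_core_elt (rough_algebra U \<theta>))"
    by (rule rough_of_iso[OF assms(2,4)])
  \<comment> \<open>The relation \<open>\<cong>\<close> also demands that both sides be CRDSAs; for
    the rough set algebra this is transported along \<open>rough_of J\<close>.\<close>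
  show ?thesis
    unfolding crdsa_isomorphic_def
    using crdsa_iso_image[OF power iso] power crdsa_iso_inv_into[OF power iso] by blast
qed

end
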